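(* Let $0<p<1$ and let $Q_0$ be a cube in $\mathbb{R}^n$. Then $\bar{\mathcal{L}}^{p,n}(Q_0)=\bar{\mathcal{L}}^{1,n}(Q_0)$ with equivalence of the corresponding norms, i.e. the two classes coincide and there is a constant $C\ge1$ such that $C^{-1}\|f\|_{\bar{\mathcal{L}}^{1,n}(Q_0)}\le\|f\|_{\bar{\mathcal{L}}^{p,n}(Q_0)}\le C\|f\|_{\bar{\mathcal{L}}^{1,n}(Q_0)}$ for all $f$ in the class.
   Context: Cubes have sides parallel to the coordinate axes; $Q(x,\rho)$ is the cube with center $x$ and side length $2\rho$, and $Q_0(x_0,\rho):=Q(x_0,\rho)\cap Q_0$. For a set $E$ of positive finite measure, $|f|_E:=\frac{1}{|E|}\int_E|f(y)|\,dy$. For $0<p<\infty$, the class $\bar{\mathcal{L}}^{p,n}(Q_0)$ consists of the functions $f\in L^1(Q_0)$ with $$\|f\|_{\bar{\mathcal{L}}^{p,n}(Q_0)}^p:=\sup_{x_0\in Q_0,\rho>0}\rho^{-n}\int_{Q_0(x_0,\rho)}\big|f(x)-|f|_{Q_0(x_0,\rho)}\big|^p\,dx<\infty.$$ *)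

theory Defs
  imports "HOL-Analysis.Analysis"
begin

text \<open>Cubes are taken closed; \<open>\<rho>\<close> is half the side length.\<close>

definition cube :: "real ^ 'n \<Rightarrow> real \<Rightarrow> (real ^ 'n) set" where
  "cube x \<rho> = {y. \<forall>i. \<bar>y $ i - x $ i\<bar> \<le> \<rho>}"

definition mean_abs :: "(real ^ 'n \<Rightarrow> real) \<Rightarrow> (real ^ 'n) set \<Rightarrow> real" where
  "mean_abs f E = (1 / measure lebesgue E) * (LINT y:E|lebesgue. \<bar>f y\<bar>)"

text \<open>The \<open>p\<close>-th power of the norm. It is computed with the nonnegative integral, so that
  infinite values are recorded as such.\<close>

definition Lbar_pow :: "real \<Rightarrow> (real ^ 'n) set \<Rightarrow> (real ^ 'n \<Rightarrow> real) \<Rightarrow> ennreal" where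
  "Lbar_pow p Q0 f =
     (SUP (x0, \<rho>) \<in> Q0 \<times> {0<..}.
        ennreal (1 / \<rho> ^ CARD('n)) *
        (\<integral>\<^sup>+ x \<in> cube x0 \<rho> \<inter> Q0.
           ennreal (\<bar>f x - mean_abs f (cube x0 \<rho> \<inter> Q0)\<bar> powr p) \<partial>lebesgue))"

text \<open>A function on \<open>Q0\<close> is represented by a function on the whole space, of which only the values
  on \<open>Q0\<close> matter.\<close>

definition Lbar :: "real \<Rightarrow> (real ^ 'n) set \<Rightarrow> (real ^ 'n \<Rightarrow> real) set" where
  "Lbar p Q0 = {f. f absolutely_integrable_on Q0 \<and> Lbar_pow p Q0 f < \<infinity>}"

text \<open>Meaningful only for \<open>f \<in> Lbar p Q0\<close>, since \<open>enn2real \<infinity> = 0\<close>.\<close>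

definition Lbar_norm :: "real \<Rightarrow> (real ^ 'n) set \<Rightarrow> (real ^ 'n \<Rightarrow> real) \<Rightarrow> real" where
  "Lbar_norm p Q0 f = enn2real (Lbar_pow p Q0 f) powr (1 / p)"

end

theory Submission
  imports Defs
begin

text \<open>The estimate of the \<open>p\<close>-norm by the \<open>1\<close>-norm is an instance of Hoelder's inequality on a set of finite
measure. The converse is a self-improvement property of John--Stroemberg type, and it is obtained by
treating \<open>\<bar>f\<bar>\<close> and the negative part of \<open>f\<close> separately. Write \<open>m\<close> for the mean of \<open>\<bar>f\<bar>\<close> over a cube.

Since \<open>m \<ge> 0\<close>, both \<open>\<bar>\<bar>f\<bar> - m\<bar>\<close> and the negative part of \<open>f\<close> are bounded pointwise by \<open>\<bar>f - m\<bar>\<close>. So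
\<open>\<bar>f\<bar>\<close> has bounded \<open>p\<close>-oscillation about its genuine means, and the \<open>p\<close>-th power of the negative part
has bounded means on all cubes, which makes the negative part essentially bounded
(\<open>integral_le_of_powr_means\<close>). What remains is to bound the \<open>L\<^sup>1\<close> oscillation of \<open>g = \<bar>f\<bar>\<close>
(\<open>mean_oscillation_le\<close>).

For this, run the dyadic martingale of \<open>g\<close> below a cube. The hypothesis bounds its jumps, and a cube
on which the mean has moved far from the reference value contributes to the \<open>p\<close>-oscillation in
proportion to its volume; such cubes therefore fill only a fixed fraction of the original one.
Restarting in them gives a geometric series and an \<open>L\<^sup>1\<close> bound on the martingale that does not depend
on the number of generations (\<open>integral_dyadic_part_diff_le\<close>). Finally the bound is carried from
unions of dyadic cubes to the level sets of \<open>g\<close> by dominated convergence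
(\<open>integral_le_of_dyadic_parts\<close>).

The sets in the definition of the norm are cubes cut off by the ambient cube. Each lies in a cube
inside the ambient one of no larger side length, and changing the constant costs a factor \<open>2\<close> only,
so that it suffices to work with cubes that are not cut off.\<close>

section \<open>Cubes and their dyadic subdivision\<close>

lemma cube_eq_cbox: "cube x r = cbox (x - (\<chi> i. r)) (x + (\<chi> i. r))"
  by (auto simp: cube_def mem_box_cart abs_le_iff algebra_simps)

lemma cube_sets [simp, intro]: "cube x r \<in> sets lebesgue"
  and cube_lmeasurable [simp, intro]: "cube x r \<in> lmeasurable"
  by (auto simp: cube_eq_cbox)

lemma measure_cube:
  fixes x :: "real ^ 'n"
  assumes "0 \<le> r"
  shows "measure lebesgue (cube x r) = (2 * r) ^ CARD('n)"
proof -
  have "cbox (x - (\<chi> i. r)) (x + (\<chi> i. r)) \<noteq> {}"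
    using assms by (auto simp: interval_ne_empty_cart)
  then have "measure lebesgue (cube x r) = (\<Prod>i\<in>(UNIV :: 'n set). 2 * r)"
    unfolding cube_eq_cbox by (simp add: content_cbox_cart)
  then show ?thesis by simp
qed

text \<open>The center of one of the \<open>2\<^sup>n\<close> cubes into which halving every side splits \<open>cube x r\<close>; \<open>T\<close> is the
set of coordinates in which the upper half is taken.\<close>

definition child :: "real ^ 'n \<Rightarrow> real \<Rightarrow> 'n set \<Rightarrow> real ^ 'n" where
  "child x r T = x + (\<chi> i. if i \<in> T then r / 2 else - (r / 2))"

lemma child_nth: "child x r T $ i = (if i \<in> T then x $ i + r / 2 else x $ i - r / 2)"
  by (simp add: child_def)

lemma cube_child_subset:
  assumes "0 \<le> r"
  shows "cube (child x r T) (r / 2) \<subseteq> cube x r"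
proof
  fix y assume y: "y \<in> cube (child x r T) (r / 2)"
  show "y \<in> cube x r"
    unfolding cube_def
  proof safe
    fix i
    have "\<bar>y $ i - child x r T $ i\<bar> \<le> r / 2"
      using y by (simp add: cube_def)
    then show "\<bar>y $ i - x $ i\<bar> \<le> r"
      using assms by (smt (verit, ccfv_threshold) child_nth field_sum_of_halves mem_Collect_eq)
  qed
qed

lemma cube_child_covers:
  assumes "y \<in> cube x r"
  shows "\<exists>T. y \<in> cube (child x r T) (r / 2)"
proof
  show "y \<in> cube (child x r {i. x $ i \<le> y $ i}) (r / 2)"
    unfolding cube_def
  proof safe
    fix i
    have "\<bar>y $ i - x $ i\<bar> \<le> r"
      using assms by (simp add: cube_def)
    then show "\<bar>y $ i - child x r {i. x $ i \<le> y $ i} $ i\<bar> \<le> r / 2"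
      by (smt (verit, ccfv_threshold) child_nth field_sum_of_halves mem_Collect_eq)
  qed
qed

lemma cube_eq_Union_children:
  assumes "0 \<le> r"
  shows "cube x r = (\<Union>T. cube (child x r T) (r / 2))"
proof
  show "(\<Union>T. cube (child x r T) (r / 2)) \<subseteq> cube x r"
    by (intro UN_least cube_child_subset assms)
qed (auto dest: cube_child_covers)

lemma negligible_Int_children:
  fixes x :: "real ^ 'n"
  assumes "T \<noteq> T'"
  shows "negligible (cube (child x r T) (r / 2) \<inter> cube (child x r T') (r / 2))"
proof -
  obtain i where i: "(i \<in> T) \<noteq> (i \<in> T')"
    using assms by blast
  have "y $ i = x $ i"
    if "y \<in> cube (child x r T) (r / 2)" "y \<in> cube (child x r T') (r / 2)" for y
  proof -
    have "\<bar>y $ i - child x r T $ i\<bar> \<le> r / 2" "\<bar>y $ i - child x r T' $ i\<bar> \<le> r / 2"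
      using that by (simp_all add: cube_def)
    then show ?thesis
      using i by (smt (verit, ccfv_threshold) child_nth field_sum_of_halves mem_Collect_eq)
  qed
  then have "cube (child x r T) (r / 2) \<inter> cube (child x r T') (r / 2)
      \<subseteq> {y. y \<bullet> axis i 1 = x $ i}"
    by (auto simp: inner_axis)
  moreover have "negligible {y :: real ^ 'n. y \<bullet> axis i 1 = x $ i}"
    by (rule negligible_standard_hyperplane) simp
  ultimately show ?thesis
    by (rule negligible_subset[rotated])
qed

text \<open>Distinct children share only pieces of hyperplanes, so integrals over them add up although the
cubes are closed.\<close>

lemma integral_Union_children:
  fixes x :: "real ^ 'n" and \<phi> :: "real ^ 'n \<Rightarrow> real"
  assumes int: "\<And>T. \<phi> integrable_on A T"
    and sub: "\<And>T. A T \<subseteq> cube (child x r T) (r / 2)"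
  shows "integral (\<Union>T. A T) \<phi> = (\<Sum>T\<in>UNIV. integral (A T) \<phi>)"
proof (rule integral_unique, rule has_integral_UN)
  show "pairwise (\<lambda>T T'. negligible (A T \<inter> A T')) UNIV"
  proof (rule pairwiseI)
    fix T T' :: "'n set" assume "T \<noteq> T'"
    then show "negligible (A T \<inter> A T')"
      by (rule negligible_subset[OF negligible_Int_children]) (use sub in blast)
  qed
qed (use int in auto)

lemma integral_cube_children:
  fixes x :: "real ^ 'n" and \<phi> :: "real ^ 'n \<Rightarrow> real"
  assumes "0 \<le> r" and "\<phi> integrable_on cube x r"
  shows "integral (cube x r) \<phi> = (\<Sum>T\<in>UNIV. integral (cube (child x r T) (r / 2)) \<phi>)"
proof -
  have "\<phi> integrable_on cube (child x r T) (r / 2)" for T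
    using assms(2) cube_child_subset[OF assms(1), of x T]
    unfolding cube_eq_cbox by (rule integrable_on_subcbox)
  then show ?thesis
    using integral_Union_children[of \<phi> "\<lambda>T. cube (child x r T) (r / 2)" x r]
    by (simp add: cube_eq_Union_children[OF assms(1), symmetric])
qed

lemma measure_cube_child:
  fixes x :: "real ^ 'n"
  assumes "0 \<le> r"
  shows "measure lebesgue (cube x r) = 2 ^ CARD('n) * measure lebesgue (cube (child x r T) (r / 2))"
  using assms by (simp add: measure_cube power_mult_distrib)

lemma measure_cube_sum_children:
  fixes x :: "real ^ 'n"
  assumes "0 \<le> r"
  shows "measure lebesgue (cube x r) = (\<Sum>T\<in>UNIV. measure lebesgue (cube (child x r T) (r / 2)))"
  using integral_cube_children[OF assms, of "\<lambda>_. 1" x]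
  by (simp only: lmeasure_integral[OF cube_lmeasurable] integrable_on_const[OF cube_lmeasurable] simp_thms)

text \<open>The union of those cubes of the \<open>k\<close>-th dyadic generation below \<open>cube x r\<close> that lie inside \<open>U\<close>. The
recursion descends from the root, so that estimates for \<open>cube x r\<close> can be proved by induction on \<open>k\<close>,
applying the hypothesis to each child separately.\<close>

primrec dyadic_part :: "nat \<Rightarrow> (real ^ 'n) set \<Rightarrow> real ^ 'n \<Rightarrow> real \<Rightarrow> (real ^ 'n) set" where
  "dyadic_part 0 U x r = (if cube x r \<subseteq> U then cube x r else {})"
| "dyadic_part (Suc k) U x r = (\<Union>T. dyadic_part k U (child x r T) (r / 2))"

lemma dyadic_part_sets [simp, intro]: "dyadic_part k U x r \<in> sets lebesgue"
  by (induction k arbitrary: x r) auto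

lemma dyadic_part_subset:
  "0 \<le> r \<Longrightarrow> dyadic_part k U x r \<subseteq> cube x r \<inter> U"
proof (induction k arbitrary: x r)
  case (Suc k)
  have "dyadic_part k U (child x r T) (r / 2) \<subseteq> cube x r \<inter> U" for T
    using Suc.IH[of "r / 2" "child x r T"] cube_child_subset[OF Suc.prems, of x T] Suc.prems
    by auto
  then show ?case by auto
qed auto

lemma dyadic_part_mono:
  "0 \<le> r \<Longrightarrow> dyadic_part k U x r \<subseteq> dyadic_part (Suc k) U x r"
proof (induction k arbitrary: x r)
  case 0
  show ?case
    using cube_eq_Union_children[OF 0, of x] by auto
next
  case (Suc k)
  have "dyadic_part k U (child x r T) (r / 2) \<subseteq> dyadic_part (Suc k) U (child x r T) (r / 2)" for T
    using Suc.prems by (intro Suc.IH) simp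
  then have "(\<Union>T. dyadic_part k U (child x r T) (r / 2))
      \<subseteq> (\<Union>T. dyadic_part (Suc k) U (child x r T) (r / 2))"
    by (intro UN_mono subset_refl)
  then show ?case
    by (simp only: dyadic_part.simps(2))
qed

lemma cube_dist_bound:
  fixes x :: "real ^ 'n"
  assumes "y \<in> cube x r" "z \<in> cube x r"
  shows "dist y z \<le> 2 * r * CARD('n)"
proof -
  have "dist y z \<le> (\<Sum>i\<in>UNIV. \<bar>(y - z) $ i\<bar>)"
    unfolding dist_norm by (rule norm_le_l1_cart)
  also have "\<dots> \<le> (\<Sum>i\<in>(UNIV :: 'n set). 2 * r)"
  proof (rule sum_mono)
    fix i
    have "\<bar>y $ i - x $ i\<bar> \<le> r" "\<bar>z $ i - x $ i\<bar> \<le> r"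
      using assms by (auto simp: cube_def)
    then show "\<bar>(y - z) $ i\<bar> \<le> 2 * r"
      by (simp add: abs_le_iff)
  qed
  finally show ?thesis by (simp add: mult.commute)
qed

lemma mem_dyadic_part:
  fixes x :: "real ^ 'n"
  assumes "ball y e \<subseteq> U"
  shows "y \<in> cube x r \<Longrightarrow> 2 * r * CARD('n) < e * 2 ^ k \<Longrightarrow> y \<in> dyadic_part k U x r"
proof (induction k arbitrary: x r)
  case 0
  have "cube x r \<subseteq> ball y e"
  proof
    fix z assume "z \<in> cube x r"
    then show "z \<in> ball y e"
      using cube_dist_bound[OF 0(1), of z] 0(2) by simp
  qed
  then show ?case
    using 0 assms by auto
next
  case (Suc k)
  obtain T where "y \<in> cube (child x r T) (r / 2)"
    using cube_child_covers Suc.prems(1) by blast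
  then have "y \<in> dyadic_part k U (child x r T) (r / 2)"
    using Suc.prems(2) by (intro Suc.IH) auto
  then show ?case by auto
qed

lemma Union_dyadic_part:
  fixes x :: "real ^ 'n"
  assumes "open U" "0 \<le> r"
  shows "(\<Union>k. dyadic_part k U x r) = cube x r \<inter> U"
proof
  show "cube x r \<inter> U \<subseteq> (\<Union>k. dyadic_part k U x r)"
  proof
    fix y assume y: "y \<in> cube x r \<inter> U"
    then obtain e where e: "0 < e" "ball y e \<subseteq> U"
      using assms(1) open_contains_ball by blast
    obtain k where "2 * r * CARD('n) / e < 2 ^ k"
      using real_arch_pow[of 2] by auto
    then have "2 * r * CARD('n) < e * 2 ^ k"
      using e(1) by (simp add: pos_divide_less_eq mult.commute)
    then show "y \<in> (\<Union>k. dyadic_part k U x r)"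
      using mem_dyadic_part[OF e(2)] y by blast
  qed
qed (use dyadic_part_subset[OF assms(2)] in blast)

text \<open>Control on finite unions of dyadic cubes is control on all measurable sets: an open set is the
increasing union of its dyadic parts, and a measurable set is, up to a null set, a decreasing
intersection of open sets. Dominated convergence carries the bound through both limits. In what
follows it takes the place of the Lebesgue differentiation theorem.\<close>

lemma integral_le_of_dyadic_parts:
  fixes x :: "real ^ 'n" and \<phi> :: "real ^ 'n \<Rightarrow> real"
  assumes r: "0 \<le> r" and int: "\<phi> absolutely_integrable_on cube x r"
    and le: "\<And>k U. integral (dyadic_part k U x r) \<phi> \<le> K"
    and S: "S \<in> sets lebesgue"
  shows "integral (cube x r \<inter> S) \<phi> \<le> K"
proof -
  have sub: "set_integrable lebesgue A \<phi>" if "A \<subseteq> cube x r" "A \<in> sets lebesgue" for A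
    using set_integrable_subset[OF int] that by auto
  have open_case: "integral (cube x r \<inter> U) \<phi> \<le> K" if U: "open U" for U
  proof -
    have "(\<lambda>k. LINT y:dyadic_part k U x r|lebesgue. \<phi> y)
        \<longlonglongrightarrow> (LINT y:(\<Union>k. dyadic_part k U x r)|lebesgue. \<phi> y)"
    proof (rule set_integral_cont_up)
      show "incseq (\<lambda>k. dyadic_part k U x r)"
        using dyadic_part_mono[OF r] by (intro incseq_SucI)
      show "set_integrable lebesgue (\<Union>k. dyadic_part k U x r) \<phi>"
        unfolding Union_dyadic_part[OF U r] using U by (intro sub) auto
    qed auto
    moreover have "(LINT y:dyadic_part k U x r|lebesgue. \<phi> y) \<le> K" for k
      using le[of k U] dyadic_part_subset[OF r, of k U x]
      by (subst set_lebesgue_integral_eq_integral) (auto intro!: sub)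
    ultimately have "(LINT y:(\<Union>k. dyadic_part k U x r)|lebesgue. \<phi> y) \<le> K"
      by (intro LIMSEQ_le_const2) auto
    then show ?thesis
      unfolding Union_dyadic_part[OF U r]
      by (subst (asm) set_lebesgue_integral_eq_integral) (use U in \<open>auto intro!: sub\<close>)
  qed
  obtain G N where G: "gdelta G" "N \<in> null_sets lebesgue" "S \<union> N = G"
    using lebesgue_set_almost_gdelta[OF S] by metis
  obtain F :: "nat \<Rightarrow> (real ^ 'n) set" where F: "\<And>k. open (F k)" "G = (\<Inter>k. F k)"
    using G(1) by (auto elim!: gdelta.cases)
  define W where "W k = (\<Inter>j\<le>k. F j)" for k
  have W: "open (W k)" for k
    unfolding W_def using F(1) by auto
  have WG: "(\<Inter>k. cube x r \<inter> W k) = cube x r \<inter> G"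
    unfolding W_def F(2) by auto
  have "(\<lambda>k. LINT y:cube x r \<inter> W k|lebesgue. \<phi> y)
      \<longlonglongrightarrow> (LINT y:(\<Inter>k. cube x r \<inter> W k)|lebesgue. \<phi> y)"
  proof (rule set_integral_cont_down)
    show "decseq (\<lambda>k. cube x r \<inter> W k)"
      unfolding decseq_def W_def by fastforce
  qed (use W in \<open>auto intro!: sub\<close>)
  moreover have "(LINT y:cube x r \<inter> W k|lebesgue. \<phi> y) \<le> K" for k
    using open_case[OF W, of k] W
    by (subst set_lebesgue_integral_eq_integral) (auto intro!: sub)
  ultimately have "(LINT y:cube x r \<inter> G|lebesgue. \<phi> y) \<le> K"
    unfolding WG by (intro LIMSEQ_le_const2) auto
  moreover have "G \<in> sets lebesgue"
    using G S by (metis null_setsD2 sets.Un)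
  ultimately have "integral (cube x r \<inter> G) \<phi> \<le> K"
    by (subst (asm) set_lebesgue_integral_eq_integral) (auto intro!: sub)
  moreover have "integral (cube x r \<inter> G) \<phi> = integral (cube x r \<inter> S) \<phi>"
  proof (rule integral_spike_set)
    have "negligible N" using G(2) by (simp add: negligible_iff_null_sets)
    then show "negligible {y \<in> cube x r \<inter> G - cube x r \<inter> S. \<phi> y \<noteq> 0}"
      by (rule negligible_subset) (use G(3) in auto)
    show "negligible {y \<in> cube x r \<inter> S - cube x r \<inter> G. \<phi> y \<noteq> 0}"
      using G(3) by (auto intro: negligible_subset[OF negligible_empty])
  qed
  ultimately show ?thesis by simp
qed

section \<open>Powers with exponent at most one\<close>

lemma powr_le_add_one:
  fixes t :: real
  assumes "0 \<le> t" "0 < p" "p \<le> 1"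
  shows "t powr p \<le> 1 + t"
proof (cases "t \<le> 1")
  case True
  then have "t powr p \<le> 1" using assms by (intro powr_le1) auto
  then show ?thesis using assms by linarith
next
  case False
  then have "t powr p \<le> t powr 1" using assms by (intro powr_mono) auto
  then show ?thesis using assms by simp
qed

text \<open>For \<open>s = \<bar>u\<bar> + \<bar>v\<bar>\<close> the fractions \<open>\<bar>u\<bar> / s\<close> and \<open>\<bar>v\<bar> / s\<close> add up to \<open>1\<close> and lie below their \<open>p\<close>-th
powers.\<close>

lemma powr_abs_add_le:
  fixes u v :: real
  assumes "0 < p" "p \<le> 1"
  shows "\<bar>u + v\<bar> powr p \<le> \<bar>u\<bar> powr p + \<bar>v\<bar> powr p"
proof (cases "\<bar>u\<bar> + \<bar>v\<bar> = 0")
  case False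
  define s where "s = \<bar>u\<bar> + \<bar>v\<bar>"
  have s: "0 < s" using False by (auto simp: s_def)
  have part: "\<bar>w\<bar> / s * s powr p \<le> \<bar>w\<bar> powr p" if "\<bar>w\<bar> \<le> s" for w
  proof -
    have "(\<bar>w\<bar> / s) powr 1 \<le> (\<bar>w\<bar> / s) powr p"
      using that s assms by (intro powr_mono') auto
    then have "\<bar>w\<bar> / s * s powr p \<le> (\<bar>w\<bar> / s) powr p * s powr p"
      using s by (intro mult_right_mono) auto
    then show ?thesis using s by (simp add: powr_divide)
  qed
  have "\<bar>u + v\<bar> powr p \<le> s powr p"
    using assms by (intro powr_mono2) (auto simp: s_def)
  also have "\<dots> = \<bar>u\<bar> / s * s powr p + \<bar>v\<bar> / s * s powr p"
    using s by (simp add: s_def add_divide_distrib[symmetric] distrib_right[symmetric])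
  also have "\<dots> \<le> \<bar>u\<bar> powr p + \<bar>v\<bar> powr p"
    by (intro add_mono part) (auto simp: s_def)
  finally show ?thesis .
next
  case True
  then have "u = 0" "v = 0" by linarith+
  then show ?thesis by simp
qed

lemma le_powr_inverse:
  fixes t b :: real
  assumes "0 \<le> t" "0 < p" "t powr p \<le> b"
  shows "t \<le> b powr (1 / p)"
proof -
  have "(t powr p) powr (1 / p) \<le> b powr (1 / p)"
    using assms by (intro powr_mono2) auto
  then show ?thesis using assms by (simp add: powr_powr)
qed

lemma powr_absolutely_integrable:
  fixes g :: "'a::euclidean_space \<Rightarrow> real"
  assumes g: "g absolutely_integrable_on A" and A: "A \<in> lmeasurable" and p: "0 < p" "p \<le> 1"
  shows "(\<lambda>y. \<bar>g y - a\<bar> powr p) absolutely_integrable_on A"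
proof (rule measurable_bounded_by_integrable_imp_absolutely_integrable)
  have gi: "(\<lambda>y. g y - a) absolutely_integrable_on A"
    using g A by (intro set_integral_diff absolutely_integrable_on_const)
  have [measurable]: "g \<in> borel_measurable (lebesgue_on A)"
    using g by (intro integrable_imp_measurable set_lebesgue_integral_eq_integral)
  show "(\<lambda>y. \<bar>g y - a\<bar> powr p) \<in> borel_measurable (lebesgue_on A)"
    by measurable
  show "(\<lambda>y. 1 + \<bar>g y - a\<bar>) integrable_on A"
    using gi A by (intro integrable_add integrable_on_const) (auto simp: absolutely_integrable_on_def)
  show "norm (\<bar>g y - a\<bar> powr p) \<le> 1 + \<bar>g y - a\<bar>" for y
    using powr_le_add_one[of "\<bar>g y - a\<bar>" p] p by simp
qed (use A in auto)

lemma integral_const_lmeasurable: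
  fixes a :: real
  assumes "A \<in> lmeasurable"
  shows "integral A (\<lambda>y. a) = a * measure lebesgue A"
  using integral_mult_right[of A a "\<lambda>y. 1"] by (simp only: lmeasure_integral[OF assms] mult_1_right)

section \<open>Functions whose p-oscillation about their means is bounded\<close>

definition mean :: "(real ^ 'n \<Rightarrow> real) \<Rightarrow> (real ^ 'n) set \<Rightarrow> real" where
  "mean g A = integral A g / measure lebesgue A"

lemma integral_diff_const:
  fixes g :: "'a::euclidean_space \<Rightarrow> real"
  assumes "g absolutely_integrable_on A" "A \<in> lmeasurable"
  shows "integral A (\<lambda>y. g y - a) = integral A g - a * measure lebesgue A"
proof -
  have "integral A (\<lambda>y. g y - a) = integral A g - integral A (\<lambda>y. a)"
    using assms by (intro integral_diff integrable_on_const set_lebesgue_integral_eq_integral)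
  then show ?thesis
    by (simp only: integral_const_lmeasurable[OF assms(2)])
qed

lemma measure_cube_pos: "0 < r \<Longrightarrow> 0 < measure lebesgue (cube x r)"
  by (simp add: measure_cube)

lemma integral_diff_mean:
  assumes "g absolutely_integrable_on cube x r" "0 < r"
  shows "integral (cube x r) (\<lambda>y. g y - a) = (mean g (cube x r) - a) * measure lebesgue (cube x r)"
  using assms measure_cube_pos[of r x]
  by (simp add: integral_diff_const mean_def left_diff_distrib)

text \<open>The subadditivity of \<open>t \<mapsto> t powr p\<close>, integrated: two constants that both approximate \<open>g\<close> on \<open>A\<close>
are close to each other, and one that is far from a good constant approximates badly.\<close>

lemma powr_diff_constants_le:
  fixes g :: "real ^ 'n \<Rightarrow> real"
  assumes g: "g absolutely_integrable_on A" and A: "A \<in> lmeasurable" and p: "0 < p" "p \<le> 1"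
  shows "\<bar>b - a\<bar> powr p * measure lebesgue A
    \<le> integral A (\<lambda>y. \<bar>g y - a\<bar> powr p) + integral A (\<lambda>y. \<bar>g y - b\<bar> powr p)"
proof -
  have int: "(\<lambda>y. \<bar>g y - c\<bar> powr p) integrable_on A" for c
    using powr_absolutely_integrable[OF g A p] by (rule set_lebesgue_integral_eq_integral)
  have "\<bar>b - a\<bar> powr p * measure lebesgue A = integral A (\<lambda>y. \<bar>b - a\<bar> powr p)"
    by (simp only: integral_const_lmeasurable[OF A])
  also have "\<dots> \<le> integral A (\<lambda>y. \<bar>g y - a\<bar> powr p + \<bar>g y - b\<bar> powr p)"
  proof (rule integral_le)
    show "(\<lambda>y. \<bar>b - a\<bar> powr p) integrable_on A"
      using A by (rule integrable_on_const)
    show "\<bar>b - a\<bar> powr p \<le> \<bar>g y - a\<bar> powr p + \<bar>g y - b\<bar> powr p" for y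
      using powr_abs_add_le[OF p, of "g y - a" "b - g y"] by (simp add: abs_minus_commute)
  qed (use int in \<open>auto intro: integrable_add\<close>)
  also have "\<dots> = integral A (\<lambda>y. \<bar>g y - a\<bar> powr p) + integral A (\<lambda>y. \<bar>g y - b\<bar> powr p)"
    using int by (intro integral_add)
  finally show ?thesis .
qed

text \<open>The stopping argument. Let \<open>a\<close> be a reference value close to the mean of \<open>g\<close> on a cube, and descend
dyadically until the mean \<open>m'\<close> on a subcube has moved farther than \<open>(3 * M) powr (1 / p)\<close> from \<open>a\<close>.
By the oscillation bound the mean jumps by at most \<open>((2 ^ n + 1) * M) powr (1 / p)\<close> from a cube to
its child, so even then \<open>\<bar>m' - a\<bar> \<le> \<kappa>\<close>. From there on \<open>g\<close> is compared with \<open>m'\<close> in place of \<open>a\<close>.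
This costs at most a multiple of the volume of the stopped cube, and that volume is paid for by
\<open>\<integral>\<bar>g - a\<bar>\<^sup>p\<close>: on a stopped cube that integral is at least \<open>2 * M\<close> times the volume.

All terms of the bound are additive over children. The bound for \<open>a\<close> and the bound for the
restart at \<open>m'\<close> therefore follow from one induction on the number of generations, with the
constant \<open>\<kappa>\<close> independent of that number.\<close>

lemma integral_dyadic_part_diff_le:
  fixes g :: "real ^ 'n \<Rightarrow> real"
  assumes g: "g absolutely_integrable_on Q" and p: "0 < p" "p \<le> 1" and M: "0 < M"
    and osc: "\<And>x r. 0 < r \<Longrightarrow> cube x r \<subseteq> Q \<Longrightarrow>
      integral (cube x r) (\<lambda>y. \<bar>g y - mean g (cube x r)\<bar> powr p) \<le> M * measure lebesgue (cube x r)"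
  defines "\<kappa> \<equiv> (3 * M) powr (1 / p) + ((2 ^ CARD('n) + 1) * M) powr (1 / p)"
  shows "0 < r \<Longrightarrow> cube x r \<subseteq> Q \<Longrightarrow> \<bar>mean g (cube x r) - a\<bar> \<le> (3 * M) powr (1 / p) \<Longrightarrow>
    integral (dyadic_part k U x r) (\<lambda>y. g y - a)
      \<le> \<kappa> * measure lebesgue (cube x r) + \<kappa> / M * integral (cube x r) (\<lambda>y. \<bar>g y - a\<bar> powr p)"
proof (induction k arbitrary: x r a)
  case (0 x r a)
  have gi: "g absolutely_integrable_on cube x r"
    using set_integrable_subset[OF g] 0(2) by auto
  have \<kappa>: "(3 * M) powr (1 / p) \<le> \<kappa>" "0 \<le> \<kappa>"
    unfolding \<kappa>_def by auto
  have "integral (dyadic_part 0 U x r) (\<lambda>y. g y - a) \<le> \<kappa> * measure lebesgue (cube x r)"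
  proof (cases "cube x r \<subseteq> U")
    case True
    have "integral (cube x r) (\<lambda>y. g y - a) \<le> \<kappa> * measure lebesgue (cube x r)"
      unfolding integral_diff_mean[OF gi 0(1)]
      using 0(3) \<kappa> by (intro mult_right_mono) auto
    then show ?thesis using True by simp
  qed (use \<kappa> in auto)
  moreover have "0 \<le> \<kappa> / M * integral (cube x r) (\<lambda>y. \<bar>g y - a\<bar> powr p)"
    using \<kappa> M by (intro mult_nonneg_nonneg integral_nonneg set_lebesgue_integral_eq_integral
        powr_absolutely_integrable[OF gi _ p]) auto
  ultimately show ?case by linarith
next
  case (Suc k x r a)
  let ?m = "mean g (cube x r)"
  have gi: "g absolutely_integrable_on cube z s" if "cube z s \<subseteq> Q" for z s
    using set_integrable_subset[OF g] that by auto
  have \<kappa>: "0 \<le> \<kappa>"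
    unfolding \<kappa>_def by auto
  have child: "integral (dyadic_part k U (child x r T) (r / 2)) (\<lambda>y. g y - a)
      \<le> \<kappa> * measure lebesgue (cube (child x r T) (r / 2))
        + \<kappa> / M * integral (cube (child x r T) (r / 2)) (\<lambda>y. \<bar>g y - a\<bar> powr p)" for T
  proof -
    define z where "z = child x r T"
    let ?c = "cube z (r / 2)"
    define m' where "m' = mean g ?c"
    have sub: "?c \<subseteq> cube x r"
      unfolding z_def using Suc.prems(1) by (intro cube_child_subset) auto
    then have cQ: "?c \<subseteq> Q" using Suc.prems(2) by auto
    have r: "0 < r / 2" using Suc.prems(1) by simp
    have pos: "0 < measure lebesgue ?c" using measure_cube_pos[OF r] .
    have osc': "integral ?c (\<lambda>y. \<bar>g y - m'\<bar> powr p) \<le> M * measure lebesgue ?c"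
      unfolding m'_def by (rule osc[OF r cQ])
    \<comment> \<open>Descend with the same reference value, or stop and restart with the mean as reference.\<close>
    show ?thesis
    proof (cases "\<bar>m' - a\<bar> \<le> (3 * M) powr (1 / p)")
      case True
      then show ?thesis
        using Suc.IH[OF r cQ, of a] unfolding m'_def z_def by simp
    next
      case False
      have int: "(\<lambda>y. \<bar>g y - c\<bar> powr p) integrable_on cube w s" if "cube w s \<subseteq> Q" for c w s
        using powr_absolutely_integrable[OF gi[OF that] _ p] set_lebesgue_integral_eq_integral by blast
      have "\<bar>m' - ?m\<bar> powr p * measure lebesgue ?c
          \<le> integral ?c (\<lambda>y. \<bar>g y - ?m\<bar> powr p) + integral ?c (\<lambda>y. \<bar>g y - m'\<bar> powr p)"
        by (rule powr_diff_constants_le[OF gi[OF cQ] _ p]) auto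
      also have "\<dots> \<le> integral (cube x r) (\<lambda>y. \<bar>g y - ?m\<bar> powr p) + M * measure lebesgue ?c"
        using sub int[OF cQ] int[OF Suc.prems(2)] osc' by (intro add_mono integral_subset_le) auto
      also have "\<dots> \<le> M * measure lebesgue (cube x r) + M * measure lebesgue ?c"
        using osc[OF Suc.prems(1,2)] by simp
      also have "\<dots> = (2 ^ CARD('n) + 1) * M * measure lebesgue ?c"
        using Suc.prems(1) measure_cube_child[of r x T] by (simp add: z_def algebra_simps)
      finally have "\<bar>m' - ?m\<bar> powr p \<le> (2 ^ CARD('n) + 1) * M"
        using pos by simp
      then have "\<bar>m' - ?m\<bar> \<le> ((2 ^ CARD('n) + 1) * M) powr (1 / p)"
        using p by (intro le_powr_inverse) auto
      with Suc.prems(3) have m'a: "m' - a \<le> \<kappa>"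
        unfolding \<kappa>_def by linarith
      \<comment> \<open>A stopped cube carries a definite amount of \<open>\<integral>\<bar>g - a\<bar>\<^sup>p\<close>.\<close>
      have "3 * M \<le> \<bar>m' - a\<bar> powr p"
      proof -
        have "((3 * M) powr (1 / p)) powr p \<le> \<bar>m' - a\<bar> powr p"
          using False p by (intro powr_mono2) auto
        then show ?thesis using p M by (simp add: powr_powr)
      qed
      then have "3 * M * measure lebesgue ?c \<le> \<bar>m' - a\<bar> powr p * measure lebesgue ?c"
        by (rule mult_right_mono) auto
      also have "\<dots> \<le> integral ?c (\<lambda>y. \<bar>g y - a\<bar> powr p) + integral ?c (\<lambda>y. \<bar>g y - m'\<bar> powr p)"
        by (rule powr_diff_constants_le[OF gi[OF cQ] _ p]) auto
      finally have "2 * M * measure lebesgue ?c \<le> integral ?c (\<lambda>y. \<bar>g y - a\<bar> powr p)"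
        using osc' by linarith
      then have "\<kappa> / M * (2 * M * measure lebesgue ?c)
          \<le> \<kappa> / M * integral ?c (\<lambda>y. \<bar>g y - a\<bar> powr p)"
        using \<kappa> M by (intro mult_left_mono) auto
      then have stopped: "2 * \<kappa> * measure lebesgue ?c
          \<le> \<kappa> / M * integral ?c (\<lambda>y. \<bar>g y - a\<bar> powr p)"
        using M by simp
      let ?P = "dyadic_part k U z (r / 2)"
      have Psub: "?P \<subseteq> ?c" using dyadic_part_subset[of "r / 2" k U z] r by auto
      then have P: "?P \<in> lmeasurable"
        by (meson cube_lmeasurable dyadic_part_sets fmeasurableI2)
      have gP: "g absolutely_integrable_on ?P"
        using set_integrable_subset[OF gi[OF cQ]] Psub by auto
      have Ple: "measure lebesgue ?P \<le> measure lebesgue ?c"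
        using Psub P by (intro measure_mono_fmeasurable) auto
      \<comment> \<open>The restart may use the induction hypothesis, since \<open>m'\<close> is the mean itself.\<close>
      have "integral ?P (\<lambda>y. g y - m')
          \<le> \<kappa> * measure lebesgue ?c + \<kappa> / M * integral ?c (\<lambda>y. \<bar>g y - m'\<bar> powr p)"
        using Suc.IH[OF r cQ, of m'] by (simp add: m'_def)
      also have "\<dots> \<le> \<kappa> * measure lebesgue ?c + \<kappa> / M * (M * measure lebesgue ?c)"
        using osc' \<kappa> M by (intro add_left_mono mult_left_mono) auto
      finally have own: "integral ?P (\<lambda>y. g y - m') \<le> 2 * \<kappa> * measure lebesgue ?c"
        using M by simp
      have "integral ?P (\<lambda>y. g y - a) = integral ?P (\<lambda>y. g y - m') + (m' - a) * measure lebesgue ?P"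
        using gP P by (simp add: integral_diff_const algebra_simps)
      also have "(m' - a) * measure lebesgue ?P \<le> \<kappa> * measure lebesgue ?c"
        using m'a Ple \<kappa> by (intro mult_mono) auto
      finally show ?thesis
        using own stopped unfolding z_def by linarith
    qed
  qed
  have r: "0 \<le> r" using Suc.prems(1) by simp
  have subQ: "cube (child x r T) (r / 2) \<subseteq> Q" for T
    using cube_child_subset[OF r, of x T] Suc.prems(2) by auto
  have "integral (dyadic_part (Suc k) U x r) (\<lambda>y. g y - a)
      = (\<Sum>T\<in>UNIV. integral (dyadic_part k U (child x r T) (r / 2)) (\<lambda>y. g y - a))"
    unfolding dyadic_part.simps
  proof (rule integral_Union_children)
    fix T
    show sub: "dyadic_part k U (child x r T) (r / 2) \<subseteq> cube (child x r T) (r / 2)"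
      using dyadic_part_subset[of "r / 2" k U "child x r T"] r by auto
    have "(\<lambda>y. g y - a) absolutely_integrable_on cube (child x r T) (r / 2)"
      using gi[OF subQ] by (intro set_integral_diff absolutely_integrable_on_const) auto
    then show "(\<lambda>y. g y - a) integrable_on dyadic_part k U (child x r T) (r / 2)"
      using sub by (intro set_lebesgue_integral_eq_integral) (auto elim: set_integrable_subset)
  qed
  also have "\<dots> \<le> (\<Sum>T\<in>UNIV. \<kappa> * measure lebesgue (cube (child x r T) (r / 2))
      + \<kappa> / M * integral (cube (child x r T) (r / 2)) (\<lambda>y. \<bar>g y - a\<bar> powr p))"
    by (intro sum_mono child)
  also have "\<dots> = \<kappa> * measure lebesgue (cube x r)
      + \<kappa> / M * integral (cube x r) (\<lambda>y. \<bar>g y - a\<bar> powr p)"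
  proof -
    have "(\<lambda>y. \<bar>g y - a\<bar> powr p) integrable_on cube x r"
      using powr_absolutely_integrable[OF gi[OF Suc.prems(2)] _ p] set_lebesgue_integral_eq_integral by blast
    then show ?thesis
      by (simp only: sum.distrib sum_distrib_left[symmetric] integral_cube_children[OF r]
          measure_cube_sum_children[OF r])
  qed
  finally show ?case .
qed

text \<open>John--Stroemberg: for oscillation about means, an \<open>L\<^sup>p\<close> bound with \<open>p \<le> 1\<close> that is uniform over
subcubes improves to an \<open>L\<^sup>1\<close> bound. Since \<open>g - m\<close> has integral zero for the mean \<open>m\<close>, the integral
of \<open>\<bar>g - m\<bar>\<close> is twice the integral of \<open>g - m\<close> over \<open>{g \<ge> m}\<close>, and the latter is a limit of
integrals over dyadic parts.\<close>

lemma mean_oscillation_le: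
  fixes g :: "real ^ 'n \<Rightarrow> real"
  assumes g: "g absolutely_integrable_on Q" and p: "0 < p" "p \<le> 1" and M: "0 < M"
    and osc: "\<And>x r. 0 < r \<Longrightarrow> cube x r \<subseteq> Q \<Longrightarrow>
      integral (cube x r) (\<lambda>y. \<bar>g y - mean g (cube x r)\<bar> powr p) \<le> M * measure lebesgue (cube x r)"
    and r: "0 < r" and sub: "cube x r \<subseteq> Q"
  shows "integral (cube x r) (\<lambda>y. \<bar>g y - mean g (cube x r)\<bar>)
    \<le> 4 * ((3 * M) powr (1 / p) + ((2 ^ CARD('n) + 1) * M) powr (1 / p))
        * measure lebesgue (cube x r)"
proof -
  define \<kappa> where "\<kappa> = (3 * M) powr (1 / p) + ((2 ^ CARD('n) + 1) * M) powr (1 / p)"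
  let ?c = "cube x r"
  define m where "m = mean g ?c"
  have gi: "g absolutely_integrable_on ?c"
    using set_integrable_subset[OF g] sub by auto
  have di: "(\<lambda>y. g y - m) absolutely_integrable_on ?c"
    using gi by (intro set_integral_diff absolutely_integrable_on_const) auto
  have "0 \<le> \<kappa>" unfolding \<kappa>_def by auto
  define S where "S = {y \<in> ?c. m \<le> g y}"
  have S: "S \<in> sets lebesgue"
  proof -
    have "g \<in> borel_measurable (lebesgue_on ?c)"
      using gi by (intro integrable_imp_measurable set_lebesgue_integral_eq_integral)
    then have "{y \<in> space (lebesgue_on ?c). m \<le> g y} \<in> sets (lebesgue_on ?c)"
      by measurable
    then show ?thesis
      by (simp add: S_def space_restrict_space sets_restrict_space_iff)
  qed
  have "integral (?c \<inter> S) (\<lambda>y. g y - m) \<le> 2 * \<kappa> * measure lebesgue ?c"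
  proof (rule integral_le_of_dyadic_parts[OF _ di _ S])
    fix k U
    have "integral (dyadic_part k U x r) (\<lambda>y. g y - m)
        \<le> \<kappa> * measure lebesgue ?c + \<kappa> / M * integral ?c (\<lambda>y. \<bar>g y - m\<bar> powr p)"
      unfolding \<kappa>_def m_def
      by (rule integral_dyadic_part_diff_le[OF g p M osc r sub]) auto
    also have "\<dots> \<le> \<kappa> * measure lebesgue ?c + \<kappa> / M * (M * measure lebesgue ?c)"
      using osc[OF r sub] \<open>0 \<le> \<kappa>\<close> M unfolding m_def by (intro add_left_mono mult_left_mono) auto
    finally show "integral (dyadic_part k U x r) (\<lambda>y. g y - m) \<le> 2 * \<kappa> * measure lebesgue ?c"
      using M by simp
  qed (use r in auto)
  moreover have "integral ?c (\<lambda>y. \<bar>g y - m\<bar>) = 2 * integral (?c \<inter> S) (\<lambda>y. g y - m)"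
  proof -
    let ?\<phi> = "\<lambda>y. if y \<in> S then g y - m else 0"
    have i1: "(\<lambda>y. g y - m) integrable_on ?c"
      using di by (rule set_lebesgue_integral_eq_integral)
    have "(\<lambda>y. g y - m) absolutely_integrable_on S \<inter> ?c"
      using di S by (elim set_integrable_subset) auto
    then have i2: "?\<phi> integrable_on ?c"
      by (subst integrable_restrict_Int) (rule set_lebesgue_integral_eq_integral)
    have "integral ?c (\<lambda>y. \<bar>g y - m\<bar>) = integral ?c (\<lambda>y. 2 * ?\<phi> y - (g y - m))"
      by (rule integral_cong) (auto simp: S_def)
    also have "\<dots> = 2 * integral ?c ?\<phi> - integral ?c (\<lambda>y. g y - m)"
      using i1 i2 by (simp add: integral_diff integrable_on_mult_right)
    also have "integral ?c (\<lambda>y. g y - m) = 0"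
      using integral_diff_mean[OF gi r, of m] by (simp add: m_def)
    also have "integral ?c ?\<phi> = integral (?c \<inter> S) (\<lambda>y. g y - m)"
      by (simp add: integral_restrict_Int Int_commute)
    finally show ?thesis by simp
  qed
  ultimately show ?thesis
    unfolding \<kappa>_def m_def by linarith
qed

lemma integral_dyadic_part_nonpos:
  fixes \<phi> :: "real ^ 'n \<Rightarrow> real"
  assumes \<phi>: "\<phi> absolutely_integrable_on Q"
    and le: "\<And>x r. 0 < r \<Longrightarrow> cube x r \<subseteq> Q \<Longrightarrow> integral (cube x r) \<phi> \<le> 0"
  shows "0 < r \<Longrightarrow> cube x r \<subseteq> Q \<Longrightarrow> integral (dyadic_part k U x r) \<phi> \<le> 0"
proof (induction k arbitrary: x r)
  case 0
  then show ?case using le by simp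
next
  case (Suc k)
  have r: "0 \<le> r" using Suc.prems(1) by simp
  have subQ: "cube (child x r T) (r / 2) \<subseteq> Q" for T
    using cube_child_subset[OF r, of x T] Suc.prems(2) by auto
  have sub: "dyadic_part k U (child x r T) (r / 2) \<subseteq> cube (child x r T) (r / 2)" for T
    using dyadic_part_subset[of "r / 2" k U "child x r T"] r by auto
  have "\<phi> integrable_on dyadic_part k U (child x r T) (r / 2)" for T
    using sub[of T] subQ[of T] \<phi>
    by (intro set_lebesgue_integral_eq_integral(1)) (auto elim!: set_integrable_subset)
  then have "integral (dyadic_part (Suc k) U x r) \<phi>
      = (\<Sum>T\<in>UNIV. integral (dyadic_part k U (child x r T) (r / 2)) \<phi>)"
    unfolding dyadic_part.simps using sub by (rule integral_Union_children)
  also have "\<dots> \<le> 0"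
    using Suc.prems(1) subQ by (intro sum_nonpos Suc.IH) auto
  finally show ?case .
qed

lemma negligible_of_integral_nonpos:
  fixes \<phi> :: "'a::euclidean_space \<Rightarrow> real"
  assumes int: "\<phi> absolutely_integrable_on S" and pos: "\<And>y. y \<in> S \<Longrightarrow> 0 < \<phi> y"
    and le: "integral S \<phi> \<le> 0" and S: "S \<in> sets lebesgue"
  shows "negligible S"
proof -
  let ?\<psi> = "\<lambda>y. indicator S y *\<^sub>R \<phi> y"
  have I: "integrable lebesgue ?\<psi>"
    using int by (simp add: set_integrable_def)
  have nn: "0 \<le> ?\<psi> y" for y
    using pos[of y] by (cases "y \<in> S") auto
  have "integral\<^sup>L lebesgue ?\<psi> = integral S \<phi>"
    using set_lebesgue_integral_eq_integral(2)[OF int] by (simp add: set_lebesgue_integral_def)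
  moreover have "0 \<le> integral\<^sup>L lebesgue ?\<psi>"
    using nn by (intro integral_nonneg_AE) auto
  ultimately have "integral\<^sup>L lebesgue ?\<psi> = 0"
    using le by linarith
  then have "AE y in lebesgue. ?\<psi> y = 0"
    using integral_nonneg_eq_0_iff_AE[OF I] nn by simp
  then have "AE y in lebesgue. y \<notin> S"
    by (rule AE_mp) (auto intro!: AE_I2 dest: pos simp: indicator_def split: if_splits)
  then have "S \<in> null_sets lebesgue"
    using S by (simp add: AE_iff_null_sets)
  then show ?thesis
    by (simp add: negligible_iff_null_sets)
qed

text \<open>A function whose \<open>p\<close>-th power has averages at most \<open>M\<close> on all subcubes is at most \<open>M powr (1 / p)\<close>
almost everywhere: \<open>h\<^sup>p - M\<close> has nonpositive integral over every subcube, hence over every measurable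
subset, in particular over the set where it is positive.\<close>

lemma integral_le_of_powr_means:
  fixes h :: "real ^ 'n \<Rightarrow> real"
  assumes h: "h absolutely_integrable_on cube x r" "\<And>y. 0 \<le> h y"
    and p: "0 < p" "p \<le> 1" and M: "0 \<le> M" and r: "0 < r"
    and le: "\<And>z s. 0 < s \<Longrightarrow> cube z s \<subseteq> cube x r \<Longrightarrow>
      integral (cube z s) (\<lambda>y. h y powr p) \<le> M * measure lebesgue (cube z s)"
  shows "integral (cube x r) h \<le> M powr (1 / p) * measure lebesgue (cube x r)"
proof -
  let ?c = "cube x r"
  define m where "m = M powr (1 / p)"
  have mp: "m powr p = M" using p M by (simp add: m_def powr_powr)
  define S where "S = {y \<in> ?c. m < h y}"
  have hi: "(\<lambda>y. h y powr p) absolutely_integrable_on ?c"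
    using powr_absolutely_integrable[OF h(1) _ p, of 0] h(2) by simp
  have \<phi>: "(\<lambda>y. h y powr p - M) absolutely_integrable_on ?c"
    using hi by (intro set_integral_diff absolutely_integrable_on_const) auto
  have S: "S \<in> sets lebesgue"
  proof -
    have "h \<in> borel_measurable (lebesgue_on ?c)"
      using h by (intro integrable_imp_measurable set_lebesgue_integral_eq_integral)
    then have "{y \<in> space (lebesgue_on ?c). m < h y} \<in> sets (lebesgue_on ?c)"
      by measurable
    then show ?thesis
      by (simp add: S_def space_restrict_space sets_restrict_space_iff)
  qed
  have "integral (?c \<inter> S) (\<lambda>y. h y powr p - M) \<le> 0"
  proof (rule integral_le_of_dyadic_parts[OF _ \<phi> _ S])
    fix k U
    have "integral (cube z s) (\<lambda>y. h y powr p - M) \<le> 0" if zs: "0 < s" "cube z s \<subseteq> ?c" for z s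
    proof -
      have "(\<lambda>y. h y powr p) absolutely_integrable_on cube z s"
        using set_integrable_subset[OF hi _ zs(2)] by auto
      then show ?thesis
        using le[OF zs] by (simp add: integral_diff_const)
    qed
    then show "integral (dyadic_part k U x r) (\<lambda>y. h y powr p - M) \<le> 0"
      using r by (intro integral_dyadic_part_nonpos[OF \<phi>]) auto
  qed (use r in auto)
  moreover have "?c \<inter> S = S" by (auto simp: S_def)
  ultimately have leS: "integral S (\<lambda>y. h y powr p - M) \<le> 0" by simp
  have "negligible S"
  proof (rule negligible_of_integral_nonpos[OF _ _ leS S])
    show "(\<lambda>y. h y powr p - M) absolutely_integrable_on S"
      using set_integrable_subset[OF \<phi> S] by (auto simp: S_def)
    show "0 < h y powr p - M" if "y \<in> S" for y
    proof -
      have "m powr p < h y powr p"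
        using that p by (intro powr_less_mono2) (auto simp: S_def m_def)
      then show ?thesis using mp by simp
    qed
  qed
  then have "integral ?c h = integral ?c (\<lambda>y. min (h y) m)"
    by (rule integral_spike) (auto simp: S_def)
  also have "\<dots> \<le> integral ?c (\<lambda>y. m)"
  proof (rule integral_le)
    have "(\<lambda>y. min (h y) m) absolutely_integrable_on ?c"
      using h(1) by (intro absolutely_integrable_min_1 absolutely_integrable_on_const) auto
    then show "(\<lambda>y. min (h y) m) integrable_on ?c"
      by (rule set_lebesgue_integral_eq_integral)
    show "(\<lambda>y. m) integrable_on ?c"
      by (rule integrable_on_const) auto
  qed auto
  also have "\<dots> = m * measure lebesgue ?c"
    by (rule integral_const_lmeasurable) auto
  finally show ?thesis by (simp add: m_def)
qed

section \<open>Oscillation about the mean of the absolute value\<close>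

lemma abs_absolutely_integrable:
  fixes f :: "'a::euclidean_space \<Rightarrow> real"
  assumes "f absolutely_integrable_on A"
  shows "(\<lambda>y. \<bar>f y\<bar>) absolutely_integrable_on A"
  using absolutely_integrable_norm[OF assms] by (simp add: o_def)

lemma mean_abs_eq_mean:
  assumes "f absolutely_integrable_on A"
  shows "mean_abs f A = mean (\<lambda>y. \<bar>f y\<bar>) A"
  using set_lebesgue_integral_eq_integral(2)[OF abs_absolutely_integrable[OF assms]]
  by (simp add: mean_abs_def mean_def)

lemma mean_abs_nonneg: "0 \<le> mean_abs f A"
  unfolding mean_abs_def set_lebesgue_integral_def
  by (intro mult_nonneg_nonneg integral_nonneg_AE) auto

text \<open>The value \<open>m\<close> of \<open>mean_abs f\<close> on a cube is nonnegative, so \<open>\<bar>\<bar>f\<bar> - m\<bar> \<le> \<bar>f - m\<bar>\<close>, and \<open>m\<close> is the mean of \<open>\<bar>f\<bar>\<close>: the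
hypothesis passes to \<open>\<bar>f\<bar>\<close>, to which the self-improvement for means applies. Likewise the negative
part of \<open>f\<close> is at most \<open>\<bar>f - m\<bar>\<close>, and is thus essentially bounded. The two estimates combine by
\<open>\<bar>f - m\<bar> \<le> \<bar>\<bar>f\<bar> - m\<bar> + 2 * max (- f) 0\<close>.\<close>

lemma cube_oscillation_le:
  fixes f :: "real ^ 'n \<Rightarrow> real"
  assumes f: "f absolutely_integrable_on Q" and p: "0 < p" "p \<le> 1" and M: "0 < M"
    and osc: "\<And>x r. 0 < r \<Longrightarrow> cube x r \<subseteq> Q \<Longrightarrow>
      integral (cube x r) (\<lambda>y. \<bar>f y - mean_abs f (cube x r)\<bar> powr p)
        \<le> M * measure lebesgue (cube x r)"
    and r: "0 < r" and sub: "cube x r \<subseteq> Q"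
  shows "integral (cube x r) (\<lambda>y. \<bar>f y - mean_abs f (cube x r)\<bar>)
    \<le> (4 * (3 powr (1 / p) + (2 ^ CARD('n) + 1) powr (1 / p)) + 2) * M powr (1 / p)
        * measure lebesgue (cube x r)"
proof -
  let ?g = "\<lambda>y. \<bar>f y\<bar>" and ?h = "\<lambda>y. max (- f y) 0"
  have fi: "f absolutely_integrable_on cube z s" if "cube z s \<subseteq> Q" for z s
    using set_integrable_subset[OF f _ that] by auto
  have h: "?h absolutely_integrable_on cube z s" if "cube z s \<subseteq> Q" for z s
  proof -
    have "(\<lambda>y. 0 - f y) absolutely_integrable_on cube z s"
      using fi[OF that] by (intro set_integral_diff absolutely_integrable_on_const) auto
    then show ?thesis
      by (intro absolutely_integrable_max_1 absolutely_integrable_on_const) auto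
  qed
  have fp: "(\<lambda>y. \<bar>f y - a\<bar> powr p) integrable_on cube z s" if "cube z s \<subseteq> Q" for z s a
    using powr_absolutely_integrable[OF fi[OF that] _ p] set_lebesgue_integral_eq_integral(1) by blast
  define m where "m = mean_abs f (cube x r)"
  have g_osc: "integral (cube z s) (\<lambda>y. \<bar>?g y - mean ?g (cube z s)\<bar> powr p)
      \<le> M * measure lebesgue (cube z s)" if zs: "0 < s" "cube z s \<subseteq> Q" for z s
  proof -
    have g: "?g absolutely_integrable_on cube z s"
      by (rule abs_absolutely_integrable[OF fi[OF zs(2)]])
    have "integral (cube z s) (\<lambda>y. \<bar>?g y - mean ?g (cube z s)\<bar> powr p)
        \<le> integral (cube z s) (\<lambda>y. \<bar>f y - mean_abs f (cube z s)\<bar> powr p)"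
    proof (rule integral_le[OF _ fp[OF zs(2)]])
      show "(\<lambda>y. \<bar>?g y - mean ?g (cube z s)\<bar> powr p) integrable_on cube z s"
        using powr_absolutely_integrable[OF g _ p] set_lebesgue_integral_eq_integral(1) by blast
      show "\<bar>?g y - mean ?g (cube z s)\<bar> powr p \<le> \<bar>f y - mean_abs f (cube z s)\<bar> powr p" for y
        using mean_abs_nonneg[of f "cube z s"] p
        unfolding mean_abs_eq_mean[OF fi[OF zs(2)], symmetric]
        by (intro powr_mono2) auto
    qed
    then show ?thesis using osc[OF zs] by linarith
  qed
  have g_le: "integral (cube x r) (\<lambda>y. \<bar>?g y - m\<bar>)
      \<le> 4 * ((3 * M) powr (1 / p) + ((2 ^ CARD('n) + 1) * M) powr (1 / p))
        * measure lebesgue (cube x r)"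
    unfolding m_def mean_abs_eq_mean[OF fi[OF sub]]
    by (rule mean_oscillation_le[OF abs_absolutely_integrable[OF f] p M g_osc r sub])
  have h_le: "integral (cube x r) ?h \<le> M powr (1 / p) * measure lebesgue (cube x r)"
  proof (rule integral_le_of_powr_means[OF h[OF sub] _ p _ r])
    fix z s assume zs: "0 < s" "cube z s \<subseteq> cube x r"
    then have zQ: "cube z s \<subseteq> Q" using sub by auto
    have "integral (cube z s) (\<lambda>y. ?h y powr p)
        \<le> integral (cube z s) (\<lambda>y. \<bar>f y - mean_abs f (cube z s)\<bar> powr p)"
    proof (rule integral_le[OF _ fp[OF zQ]])
      show "(\<lambda>y. ?h y powr p) integrable_on cube z s"
        using set_lebesgue_integral_eq_integral(1)
          [OF powr_absolutely_integrable[OF h[OF zQ] _ p, of 0]] by simp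
      show "?h y powr p \<le> \<bar>f y - mean_abs f (cube z s)\<bar> powr p" for y
        using mean_abs_nonneg[of f "cube z s"] p by (intro powr_mono2) auto
    qed
    then show "integral (cube z s) (\<lambda>y. ?h y powr p) \<le> M * measure lebesgue (cube z s)"
      using osc[OF zs(1) zQ] by linarith
  qed (use M in auto)
  have "?g absolutely_integrable_on cube x r"
    by (rule abs_absolutely_integrable[OF fi[OF sub]])
  then have "(\<lambda>y. ?g y - m) absolutely_integrable_on cube x r"
    by (intro set_integral_diff absolutely_integrable_on_const) auto
  then have gi: "(\<lambda>y. \<bar>?g y - m\<bar>) integrable_on cube x r"
    using abs_absolutely_integrable set_lebesgue_integral_eq_integral(1) by blast
  have "(\<lambda>y. f y - m) absolutely_integrable_on cube x r"
    using fi[OF sub] by (intro set_integral_diff absolutely_integrable_on_const) auto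
  then have fmi: "(\<lambda>y. \<bar>f y - m\<bar>) integrable_on cube x r"
    using abs_absolutely_integrable set_lebesgue_integral_eq_integral(1) by blast
  have hi: "?h integrable_on cube x r"
    by (rule set_lebesgue_integral_eq_integral(1)[OF h[OF sub]])
  have "integral (cube x r) (\<lambda>y. \<bar>f y - m\<bar>) \<le> integral (cube x r) (\<lambda>y. \<bar>?g y - m\<bar> + 2 * ?h y)"
    using fmi gi hi by (intro integral_le integrable_add integrable_on_mult_right) auto
  also have "\<dots> = integral (cube x r) (\<lambda>y. \<bar>?g y - m\<bar>) + 2 * integral (cube x r) ?h"
    using gi hi by (simp add: integral_add integrable_on_mult_right)
  also have "\<dots> \<le> 4 * ((3 * M) powr (1 / p) + ((2 ^ CARD('n) + 1) * M) powr (1 / p))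
        * measure lebesgue (cube x r) + 2 * (M powr (1 / p) * measure lebesgue (cube x r))"
    using g_le h_le by linarith
  also have "\<dots> = (4 * (3 powr (1 / p) + (2 ^ CARD('n) + 1) powr (1 / p)) + 2) * M powr (1 / p)
        * measure lebesgue (cube x r)"
    by (simp only: powr_mult) (simp add: algebra_simps)
  finally show ?thesis unfolding m_def .
qed



section \<open>Cubes cut off by a larger cube\<close>

text \<open>A cube cut off by \<open>cube c R\<close> is in general only a box, but moving its center inwards yields a cube
of no larger side length that still covers it and lies inside \<open>cube c R\<close>.\<close>

lemma Int_cube_subset_subcube:
  fixes c :: "real ^ 'n"
  assumes x: "x \<in> cube c R" and r: "0 < r"
  obtains z where "cube x r \<inter> cube c R \<subseteq> cube z (min r R)" "cube z (min r R) \<subseteq> cube c R"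
proof
  define s where "s = min r R"
  \<comment> \<open>\<open>x\<close> clamped to the centers whose cube stays inside\<close>
  define z where "z = (\<chi> i. max (c $ i - R + s) (min (x $ i) (c $ i + R - s)))"
  have xi: "\<bar>x $ i - c $ i\<bar> \<le> R" for i
    using x by (simp add: cube_def)
  have zi: "z $ i = max (c $ i - R + s) (min (x $ i) (c $ i + R - s))" for i
    by (simp add: z_def)
  have 1: "\<bar>y $ i - z $ i\<bar> \<le> s" if "\<bar>y $ i - x $ i\<bar> \<le> r" "\<bar>y $ i - c $ i\<bar> \<le> R" for y i
    using that xi[of i] unfolding zi s_def min_def max_def by (smt (verit))
  have 2: "\<bar>y $ i - c $ i\<bar> \<le> R" if "\<bar>y $ i - z $ i\<bar> \<le> s" for y i
    using that unfolding zi s_def min_def max_def by (smt (verit))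
  show "cube x r \<inter> cube c R \<subseteq> cube z (min r R)"
    unfolding cube_def s_def[symmetric] by (intro subsetI CollectI allI 1) simp_all
  show "cube z (min r R) \<subseteq> cube c R"
    unfolding cube_def s_def[symmetric] by (intro subsetI CollectI allI 2) simp
qed

lemma measure_Int_cube_le:
  fixes x :: "real ^ 'n"
  assumes "0 < r" "Q \<in> sets lebesgue"
  shows "measure lebesgue (cube x r \<inter> Q) \<le> (2 * r) ^ CARD('n)"
proof -
  have "measure lebesgue (cube x r \<inter> Q) \<le> measure lebesgue (cube x r)"
    using assms by (intro measure_mono_fmeasurable) auto
  then show ?thesis using assms by (simp add: measure_cube)
qed

text \<open>Up to the factor \<open>2\<close>, the mean of \<open>\<bar>f\<bar>\<close> is the best nonnegative constant for the \<open>L\<^sup>1\<close> oscillation.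
This allows the constant of a larger cube to be used on \<open>E\<close>.\<close>

lemma integral_abs_diff_mean_abs_le:
  fixes f :: "real ^ 'n \<Rightarrow> real"
  assumes f: "f absolutely_integrable_on E" and E: "E \<in> lmeasurable" and a: "0 \<le> a"
  shows "integral E (\<lambda>y. \<bar>f y - mean_abs f E\<bar>) \<le> 2 * integral E (\<lambda>y. \<bar>f y - a\<bar>)"
proof -
  let ?m = "mean_abs f E"
  have g: "(\<lambda>y. \<bar>f y\<bar>) absolutely_integrable_on E"
    by (rule abs_absolutely_integrable[OF f])
  have i: "(\<lambda>y. \<bar>f y - b\<bar>) integrable_on E" for b
  proof -
    have "(\<lambda>y. f y - b) absolutely_integrable_on E"
      using f E by (intro set_integral_diff absolutely_integrable_on_const)
    then show ?thesis
      using abs_absolutely_integrable set_lebesgue_integral_eq_integral(1) by blast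
  qed
  have "\<bar>?m - a\<bar> * measure lebesgue E \<le> integral E (\<lambda>y. \<bar>f y - a\<bar>)"
  proof (cases "measure lebesgue E = 0")
    case True
    then show ?thesis by (simp add: integral_nonneg[OF i])
  next
    case False
    then have "?m * measure lebesgue E = integral E (\<lambda>y. \<bar>f y\<bar>)"
      by (simp add: mean_abs_eq_mean[OF f] mean_def)
    then have "(?m - a) * measure lebesgue E = integral E (\<lambda>y. \<bar>f y\<bar> - a)"
      using integral_diff_const[OF g E, of a] by (simp add: left_diff_distrib)
    then have "\<bar>?m - a\<bar> * measure lebesgue E = \<bar>integral E (\<lambda>y. \<bar>f y\<bar> - a)\<bar>"
      by (metis abs_mult abs_of_nonneg measure_nonneg)
    also have "\<dots> \<le> integral E (\<lambda>y. \<bar>f y - a\<bar>)"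
    proof -
      have "(\<lambda>y. \<bar>f y\<bar> - a) integrable_on E"
        using g E by (intro integrable_diff integrable_on_const set_lebesgue_integral_eq_integral)
      then have "norm (integral E (\<lambda>y. \<bar>f y\<bar> - a)) \<le> integral E (\<lambda>y. \<bar>f y - a\<bar>)"
        using a by (intro integral_norm_bound_integral i) auto
      then show ?thesis by simp
    qed
    finally show ?thesis .
  qed
  moreover have "integral E (\<lambda>y. \<bar>f y - ?m\<bar>) \<le> integral E (\<lambda>y. \<bar>f y - a\<bar> + \<bar>?m - a\<bar>)"
    using i E by (intro integral_le integrable_add integrable_on_const) auto
  moreover have "\<dots> = integral E (\<lambda>y. \<bar>f y - a\<bar>) + \<bar>?m - a\<bar> * measure lebesgue E"
    using i E by (simp add: integral_add integrable_on_const integral_const_lmeasurable)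
  ultimately show ?thesis by linarith
qed

section \<open>Comparison of the two norms\<close>

lemma set_nn_integral_eq_integral:
  fixes \<phi> :: "'a::euclidean_space \<Rightarrow> real"
  assumes int: "\<phi> absolutely_integrable_on E" and nn: "\<And>y. 0 \<le> \<phi> y"
  shows "(\<integral>\<^sup>+ y \<in> E. ennreal (\<phi> y) \<partial>lebesgue) = ennreal (integral E \<phi>)"
proof -
  have "(\<integral>\<^sup>+ y \<in> E. ennreal (\<phi> y) \<partial>lebesgue)
      = (\<integral>\<^sup>+ y. ennreal (indicator E y *\<^sub>R \<phi> y) \<partial>lebesgue)"
    by (intro nn_integral_cong) (auto simp: indicator_def)
  also have "\<dots> = ennreal (integral\<^sup>L lebesgue (\<lambda>y. indicator E y *\<^sub>R \<phi> y))"
    using int nn by (intro nn_integral_eq_integral) (auto simp: set_integrable_def)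
  also have "integral\<^sup>L lebesgue (\<lambda>y. indicator E y *\<^sub>R \<phi> y) = integral E \<phi>"
    using set_lebesgue_integral_eq_integral(2)[OF int] by (simp add: set_lebesgue_integral_def)
  finally show ?thesis .
qed

lemma Lbar_pow_le_iff:
  fixes f :: "real ^ 'n \<Rightarrow> real"
  assumes f: "f absolutely_integrable_on Q" and Q: "Q \<in> lmeasurable" and p: "0 < p" "p \<le> 1"
    and N: "0 \<le> N"
  shows "Lbar_pow p Q f \<le> ennreal N \<longleftrightarrow>
    (\<forall>x\<in>Q. \<forall>r>0. integral (cube x r \<inter> Q) (\<lambda>y. \<bar>f y - mean_abs f (cube x r \<inter> Q)\<bar> powr p)
      \<le> N * r ^ CARD('n))"
proof -
  have "ennreal (1 / r ^ CARD('n)) *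
        (\<integral>\<^sup>+ y \<in> cube x r \<inter> Q. ennreal (\<bar>f y - mean_abs f (cube x r \<inter> Q)\<bar> powr p) \<partial>lebesgue)
      \<le> ennreal N
    \<longleftrightarrow> integral (cube x r \<inter> Q) (\<lambda>y. \<bar>f y - mean_abs f (cube x r \<inter> Q)\<bar> powr p)
      \<le> N * r ^ CARD('n)" if r: "0 < r" for x r
  proof -
    let ?E = "cube x r \<inter> Q"
    let ?I = "integral ?E (\<lambda>y. \<bar>f y - mean_abs f ?E\<bar> powr p)"
    have E: "?E \<in> lmeasurable" using Q by auto
    have "f absolutely_integrable_on ?E"
      using f E by (elim set_integrable_subset) auto
    then have \<phi>: "(\<lambda>y. \<bar>f y - mean_abs f ?E\<bar> powr p) absolutely_integrable_on ?E"
      using powr_absolutely_integrable[OF _ E p] by blast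
    have "ennreal (1 / r ^ CARD('n)) * ennreal ?I \<le> ennreal N \<longleftrightarrow> 1 / r ^ CARD('n) * ?I \<le> N"
      using r N by (simp add: ennreal_mult'[symmetric] ennreal_le_iff del: times_divide_eq_left)
    also have "\<dots> \<longleftrightarrow> ?I \<le> N * r ^ CARD('n)"
      using r by (simp add: pos_divide_le_eq)
    finally show ?thesis
      by (simp add: set_nn_integral_eq_integral[OF \<phi>])
  qed
  then show ?thesis
    unfolding Lbar_pow_def SUP_le_iff by auto
qed

text \<open>The self-improvement on cubes inside \<open>cube c R\<close> is transferred to the cut-off cubes that define the
norm by covering each of them with an inner cube; the covering cube has volume at most \<open>(2 * r) ^ n\<close>.\<close>

lemma Lbar_pow_one_le:
  fixes f :: "real ^ 'n \<Rightarrow> real" and c :: "real ^ 'n"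
  assumes f: "f absolutely_integrable_on cube c R" and p: "0 < p" "p \<le> 1" and M: "0 < M"
    and R: "0 < R" and le: "Lbar_pow p (cube c R) f \<le> ennreal M"
  shows "Lbar_pow 1 (cube c R) f \<le>
    ennreal (2 ^ CARD('n) * (2 * (4 * (3 powr (1 / p) + (2 ^ CARD('n) + 1) powr (1 / p)) + 2))
      * M powr (1 / p))"
proof -
  define K where "K = 4 * (3 powr (1 / p) + (2 ^ CARD('n) + 1) powr (1 / p)) + 2"
  let ?Q = "cube c R"
  have K: "0 \<le> K" by (simp add: K_def)
  have fi: "f absolutely_integrable_on E" if "E \<subseteq> ?Q" "E \<in> sets lebesgue" for E
    using set_integrable_subset[OF f] that by auto
  have osc: "integral (cube x r) (\<lambda>y. \<bar>f y - mean_abs f (cube x r)\<bar> powr p)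
      \<le> M * measure lebesgue (cube x r)" if r: "0 < r" and sub: "cube x r \<subseteq> ?Q" for x r
  proof -
    have "x \<in> cube x r" using r by (simp add: cube_def)
    then have "x \<in> ?Q" using sub by blast
    moreover have "cube x r \<inter> ?Q = cube x r" using sub by auto
    ultimately have "integral (cube x r) (\<lambda>y. \<bar>f y - mean_abs f (cube x r)\<bar> powr p)
        \<le> M * r ^ CARD('n)"
      using le r M by (subst (asm) Lbar_pow_le_iff[OF f _ p]) force+
    also have "\<dots> \<le> M * (2 * r) ^ CARD('n)"
      using M r by (intro mult_left_mono power_mono) auto
    finally show ?thesis
      using r by (simp add: measure_cube)
  qed
  have "integral (cube x r \<inter> ?Q) (\<lambda>y. \<bar>f y - mean_abs f (cube x r \<inter> ?Q)\<bar>)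
      \<le> 2 ^ CARD('n) * (2 * K) * M powr (1 / p) * r ^ CARD('n)" if x: "x \<in> ?Q" and r: "0 < r" for x r
  proof -
    let ?E = "cube x r \<inter> ?Q"
    define s where "s = min r R"
    obtain z where z: "?E \<subseteq> cube z s" "cube z s \<subseteq> ?Q"
      using Int_cube_subset_subcube[OF x r] unfolding s_def by metis
    have s: "0 < s" "s \<le> r" using r R by (auto simp: s_def)
    let ?a = "mean_abs f (cube z s)"
    have int: "(\<lambda>y. \<bar>f y - ?a\<bar>) integrable_on E" if "E \<subseteq> ?Q" "E \<in> lmeasurable" for E
    proof -
      have "(\<lambda>y. f y - ?a) absolutely_integrable_on E"
        using fi[OF that(1)] that(2) by (intro set_integral_diff absolutely_integrable_on_const) auto
      then show ?thesis
        using abs_absolutely_integrable set_lebesgue_integral_eq_integral(1) by blast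
    qed
    have "integral ?E (\<lambda>y. \<bar>f y - mean_abs f ?E\<bar>) \<le> 2 * integral ?E (\<lambda>y. \<bar>f y - ?a\<bar>)"
      by (intro integral_abs_diff_mean_abs_le fi mean_abs_nonneg) auto
    also have "integral ?E (\<lambda>y. \<bar>f y - ?a\<bar>) \<le> integral (cube z s) (\<lambda>y. \<bar>f y - ?a\<bar>)"
      using z by (intro integral_subset_le int) auto
    also have "\<dots> \<le> K * M powr (1 / p) * measure lebesgue (cube z s)"
      unfolding K_def by (rule cube_oscillation_le[OF f p M osc s(1) z(2)])
    also have "measure lebesgue (cube z s) = (2 * s) ^ CARD('n)"
      using s by (simp add: measure_cube)
    also have "K * M powr (1 / p) * (2 * s) ^ CARD('n) \<le> K * M powr (1 / p) * (2 * r) ^ CARD('n)"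
      using s K by (intro mult_left_mono power_mono) auto
    finally show ?thesis
      by (simp add: power_mult_distrib algebra_simps)
  qed
  then show ?thesis
    unfolding K_def[symmetric] using K
    by (subst Lbar_pow_le_iff[OF f]) auto
qed

text \<open>Choosing \<open>s\<close> as the \<open>L\<^sup>1\<close> bound makes both terms on the right scale alike after integration, so this
pointwise inequality serves as Hoelder's inequality.\<close>

lemma powr_le_linear:
  fixes t s :: real
  assumes "0 \<le> t" "0 < s" "0 < p" "p \<le> 1"
  shows "t powr p \<le> s powr p * (1 + t / s)"
proof -
  have "t powr p = s powr p * (t / s) powr p"
    using assms by (simp add: powr_divide)
  also have "\<dots> \<le> s powr p * (1 + t / s)"
    using assms by (intro mult_left_mono powr_le_add_one) auto
  finally show ?thesis .
qed

lemma Lbar_pow_le_of_one: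
  fixes f :: "real ^ 'n \<Rightarrow> real" and Q :: "(real ^ 'n) set"
  assumes f: "f absolutely_integrable_on Q" and Q: "Q \<in> lmeasurable" and p: "0 < p" "p \<le> 1"
    and N: "0 < N" and le: "Lbar_pow 1 Q f \<le> ennreal N"
  shows "Lbar_pow p Q f \<le> ennreal ((2 ^ CARD('n) + 1) * N powr p)"
proof -
  have "integral (cube x r \<inter> Q) (\<lambda>y. \<bar>f y - mean_abs f (cube x r \<inter> Q)\<bar> powr p)
      \<le> (2 ^ CARD('n) + 1) * N powr p * r ^ CARD('n)" if x: "x \<in> Q" and r: "0 < r" for x r
  proof -
    let ?E = "cube x r \<inter> Q"
    let ?u = "\<lambda>y. \<bar>f y - mean_abs f ?E\<bar>"
    have E: "?E \<in> lmeasurable" using Q by auto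
    have fE: "f absolutely_integrable_on ?E"
      using set_integrable_subset[OF f] E by auto
    have ui: "?u integrable_on ?E"
      using set_lebesgue_integral_eq_integral(1)
        [OF powr_absolutely_integrable[OF fE E, of 1 "mean_abs f ?E"]] by simp
    have "integral ?E ?u \<le> N * r ^ CARD('n)"
      using le x r N Lbar_pow_le_iff[OF f Q, of 1 N] by auto
    have "integral ?E (\<lambda>y. ?u y powr p) \<le> integral ?E (\<lambda>y. N powr p + N powr p / N * ?u y)"
    proof (rule integral_le)
      show "(\<lambda>y. ?u y powr p) integrable_on ?E"
        by (rule set_lebesgue_integral_eq_integral(1)[OF powr_absolutely_integrable[OF fE E p]])
      show "(\<lambda>y. N powr p + N powr p / N * ?u y) integrable_on ?E"
        using ui E by (intro integrable_add integrable_on_const integrable_on_mult_right)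
      show "?u y powr p \<le> N powr p + N powr p / N * ?u y" for y
        using powr_le_linear[of "?u y" N p] N p by (simp add: distrib_left)
    qed
    also have "\<dots> = N powr p * measure lebesgue ?E + N powr p / N * integral ?E ?u"
      using ui E
      by (simp only: integral_add integrable_on_const integrable_on_mult_right
          integral_const_lmeasurable integral_mult_right)
    also have "\<dots> \<le> N powr p * (2 * r) ^ CARD('n) + N powr p / N * (N * r ^ CARD('n))"
      using measure_Int_cube_le[OF r, of Q x] Q N \<open>integral ?E ?u \<le> _\<close>
      by (intro add_mono mult_left_mono) auto
    also have "\<dots> = (2 ^ CARD('n) + 1) * N powr p * r ^ CARD('n)"
      using N by (simp add: power_mult_distrib algebra_simps)
    finally show ?thesis .
  qed
  then show ?thesis
    by (subst Lbar_pow_le_iff[OF f Q p]) auto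
qed

text \<open>The comparison of the norms is available for positive bounds only; this also covers a norm equal to
zero.\<close>

lemma le_powr_of_all_greater:
  fixes l m K q :: real
  assumes le: "\<And>M. 0 < M \<Longrightarrow> m \<le> M \<Longrightarrow> l \<le> K * M powr q"
    and "0 \<le> m" "0 < q" "0 < K"
  shows "l \<le> K * m powr q"
proof (cases "m = 0")
  case True
  show ?thesis
  proof (rule ccontr)
    assume "\<not> l \<le> K * m powr q"
    then have l: "0 < l" using True by simp
    define M where "M = (l / (2 * K)) powr (1 / q)"
    have "M powr q = l / (2 * K)"
      using l assms by (simp add: M_def powr_powr)
    moreover have "l \<le> K * M powr q"
      using l assms True by (intro le) (auto simp: M_def)
    ultimately show False using l assms by simp
  qed
qed (use assms in auto)

theorem theorem3p2:
  fixes p :: real and Q0 :: "(real ^ 'n) set" and c :: "real ^ 'n" and R :: real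
  assumes "0 < p" and "p < 1"
    and "0 < R" and "Q0 = cube c R"
  shows "Lbar p Q0 = Lbar 1 Q0 \<and>
    (\<exists>C\<ge>1. \<forall>f\<in>Lbar p Q0.
       inverse C * Lbar_norm 1 Q0 f \<le> Lbar_norm p Q0 f \<and>
       Lbar_norm p Q0 f \<le> C * Lbar_norm 1 Q0 f)"
proof -
  define K where "K = 2 ^ CARD('n) *
    (2 * (4 * (3 powr (1 / p) + (2 ^ CARD('n) + 1) powr (1 / p)) + 2))"
  define L where "L = (2 ^ CARD('n) + 1 :: real)"
  have p: "0 < p" "p \<le> 1" using assms by auto
  have Q: "Q0 \<in> lmeasurable" using assms by auto
  have K: "1 \<le> K"
  proof -
    have "1 * 1 \<le> K"
      unfolding K_def by (intro mult_mono) (auto intro: add_nonneg_nonneg add_increasing)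
    then show ?thesis by simp
  qed
  have L: "0 < L" by (simp add: L_def add_pos_pos)
  have one_le: "Lbar_pow 1 Q0 f \<le> ennreal (K * M powr (1 / p))"
    if "f absolutely_integrable_on Q0" "0 < M" "Lbar_pow p Q0 f \<le> ennreal M" for f M
    using Lbar_pow_one_le[OF _ p] that assms unfolding K_def by blast
  have p_le: "Lbar_pow p Q0 f \<le> ennreal (L * N powr p)"
    if "f absolutely_integrable_on Q0" "0 < N" "Lbar_pow 1 Q0 f \<le> ennreal N" for f N
    using Lbar_pow_le_of_one[OF that(1) Q p that(2,3)] unfolding L_def .
  have fin: "\<exists>M>0. A \<le> ennreal M" if "A < \<infinity>" for A
    using that by (cases A) (auto intro!: exI[of _ "enn2real A + 1"] ennreal_leI)
  have "Lbar p Q0 = Lbar 1 Q0"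
  proof (intro set_eqI iffI)
    fix f assume "f \<in> Lbar p Q0"
    then show "f \<in> Lbar 1 Q0"
      using fin[of "Lbar_pow p Q0 f"] one_le[of f] unfolding Lbar_def
      by (auto intro: le_less_trans[OF _ ennreal_less_top])
  next
    fix f assume "f \<in> Lbar 1 Q0"
    then show "f \<in> Lbar p Q0"
      using fin[of "Lbar_pow 1 Q0 f"] p_le[of f] unfolding Lbar_def
      by (auto intro: le_less_trans[OF _ ennreal_less_top])
  qed
  moreover have "inverse C * Lbar_norm 1 Q0 f \<le> Lbar_norm p Q0 f
      \<and> Lbar_norm p Q0 f \<le> C * Lbar_norm 1 Q0 f"
    if C: "C = max K (L powr (1 / p))" and f: "f \<in> Lbar p Q0" for C f
  proof -
    define m l where "m = enn2real (Lbar_pow p Q0 f)" and "l = enn2real (Lbar_pow 1 Q0 f)"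
    have fi: "f absolutely_integrable_on Q0" and fp: "Lbar_pow p Q0 f < \<infinity>"
      using f by (auto simp: Lbar_def)
    have "f \<in> Lbar 1 Q0" using f \<open>Lbar p Q0 = Lbar 1 Q0\<close> by simp
    then have f1: "Lbar_pow 1 Q0 f < \<infinity>" by (simp add: Lbar_def)
    have m: "0 \<le> m" "Lbar_pow p Q0 f = ennreal m"
      and l: "0 \<le> l" "Lbar_pow 1 Q0 f = ennreal l"
      using fp f1 by (auto simp: m_def l_def)
    have C1: "1 \<le> C" using K C by simp
    have "l \<le> K * m powr (1 / p)"
    proof (rule le_powr_of_all_greater)
      fix M :: real assume "0 < M" "m \<le> M"
      then have "ennreal l \<le> ennreal (K * M powr (1 / p))"
        using one_le[OF fi, of M] m l by (simp add: ennreal_leI)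
      then show "l \<le> K * M powr (1 / p)"
        using K by (simp add: ennreal_le_iff)
    qed (use m p K in auto)
    also have "\<dots> \<le> C * m powr (1 / p)"
      using C by (intro mult_right_mono) auto
    finally have "l / C \<le> m powr (1 / p)"
      using C1 by (simp add: pos_divide_le_eq mult.commute)
    then have 1: "inverse C * l \<le> m powr (1 / p)"
      by (simp add: divide_inverse mult.commute)
    have "m \<le> L * l powr p"
    proof (rule le_powr_of_all_greater)
      fix N :: real assume "0 < N" "l \<le> N"
      then have "ennreal m \<le> ennreal (L * N powr p)"
        using p_le[OF fi, of N] m l by (simp add: ennreal_leI)
      then show "m \<le> L * N powr p"
        using L by (simp add: ennreal_le_iff)
    qed (use l p L in auto)
    then have "m powr (1 / p) \<le> (L * l powr p) powr (1 / p)"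
      using m p by (intro powr_mono2) auto
    also have "\<dots> = L powr (1 / p) * l"
      using L l p by (simp add: powr_mult powr_powr)
    also have "\<dots> \<le> C * l"
      using C l by (intro mult_right_mono) auto
    finally have "m powr (1 / p) \<le> C * l" .
    with 1 show ?thesis
      using l(1) by (simp add: Lbar_norm_def m_def l_def)
  qed
  moreover have "1 \<le> max K (L powr (1 / p))" using K by simp
  ultimately show ?thesis by blast
qed

end
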